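(* Let $k\ge2$ and $0<\lambda<1$, let $\mathcal U$ be a finite set of items, and let $\mathcal O$ be a maximizer of $F(\mathcal S)=\lambda Q(\mathcal S)+(1-\lambda)D(\mathcal S)$ over all $\mathcal S\subseteq\mathcal U$ with $|\mathcal S|=k$. Let $\mathrm{DGDS}(\mathcal U)$ be the $k$-element output of the distributed greedy algorithm described in the context. Then $$F\bigl(\mathrm{DGDS}(\mathcal U)\bigr)\ \ge\ \frac1{16}\,F(\mathcal O).$$
   Context: $q:\mathcal U\to[0,\infty)$ is a quality function and $d$ is a metric on $\mathcal U$. For finite $\mathcal S\subseteq\mathcal U$, $Q(\mathcal S)=\sum_{u\in\mathcal S}q(u)$ and $D(\mathcal S)=\sum_{u,v\in\mathcal S}d(u,v)$ (sum over ordered pairs). Greedy selection $\mathrm{ALG1}(\mathcal T\mid k,\lambda)$ for a finite set $\mathcal T$ with $|\mathcal T|\ge k$: start with $\mathcal S=\{\arg\max_{t\in\mathcal T}q(t)\}$; then, $k-1$ times, add to $\mathcal S$ an element $t\in\mathcal T\setminus\mathcal S$ maximizing $\lambda q(t)+(1-\lambda)\sum_{u\in\mathcal S}d(t,u)$. Ties are broken arbitrarily. $\mathrm{AltGreedy}(\mathcal T)$: start with $\mathcal S=\emptyset$ and, $k$ times, add to $\mathcal S$ an element $t\in\mathcal T\setminus\mathcal S$ maximizing $\tfrac12\lambda\,[Q(\mathcal S\cup\{t\})-Q(\mathcal S)]+(1-\lambda)\,[D(\mathcal S\cup\{t\})-D(\mathcal S)]$ (greedy selection in which the quality gain is scaled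 by $1/2$). $\mathrm{DGDS}(\mathcal U)$: partition $\mathcal U$ (at random) into $l$ parts $\mathcal U_1,\dots,\mathcal U_l$, each with at least $k$ elements; for each $i$ compute $\mathcal S_i=\mathrm{ALG1}(\mathcal U_i\mid k,\lambda)$; output $\mathrm{AltGreedy}\bigl(\bigcup_{i=1}^l\mathcal S_i\bigr)$. The inequality is asserted for the resulting output, with no expectation over the partition. *)

theory Defs
  imports "HOL-Analysis.Abstract_Metric_Spaces" "HOL-Library.Disjoint_Sets"
begin

definition Qual :: "('a \<Rightarrow> real) \<Rightarrow> 'a set \<Rightarrow> real" where
  "Qual q S = (\<Sum>u\<in>S. q u)"

text \<open>The sum ranges over ordered pairs, so each unordered pair is counted twice.\<close>

definition Div :: "('a \<Rightarrow> 'a \<Rightarrow> real) \<Rightarrow> 'a set \<Rightarrow> real" where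
  "Div d S = (\<Sum>(u, v)\<in>S \<times> S. d u v)"

definition Obj :: "('a \<Rightarrow> real) \<Rightarrow> ('a \<Rightarrow> 'a \<Rightarrow> real) \<Rightarrow> real \<Rightarrow> 'a set \<Rightarrow> real" where
  "Obj q d lam S = lam * Qual q S + (1 - lam) * Div d S"

text \<open>
  Ties are broken arbitrarily, so the greedy procedures are relations:
  \<open>alg1 q d lam T k S\<close> holds iff \<open>S\<close> is the result after \<open>k\<close> selections for some way of
  breaking ties, and likewise for \<open>alt_greedy\<close>.  Each selection adds a new element, so results
  have exactly \<open>k\<close> elements, and there are none when \<open>T\<close> has fewer than \<open>k\<close> elements.
\<close>

inductive alg1 ::
  "('a \<Rightarrow> real) \<Rightarrow> ('a \<Rightarrow> 'a \<Rightarrow> real) \<Rightarrow> real \<Rightarrow> 'a set \<Rightarrow> nat \<Rightarrow> 'a set \<Rightarrow> bool"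
  for q d lam T where
  init: "is_arg_max q (\<lambda>t. t \<in> T) t \<Longrightarrow> alg1 q d lam T 1 {t}"
| step: "alg1 q d lam T n S \<Longrightarrow>
    is_arg_max (\<lambda>t. lam * q t + (1 - lam) * (\<Sum>u\<in>S. d t u)) (\<lambda>t. t \<in> T - S) t \<Longrightarrow>
    alg1 q d lam T (Suc n) (S \<union> {t})"

inductive alt_greedy ::
  "('a \<Rightarrow> real) \<Rightarrow> ('a \<Rightarrow> 'a \<Rightarrow> real) \<Rightarrow> real \<Rightarrow> 'a set \<Rightarrow> nat \<Rightarrow> 'a set \<Rightarrow> bool"
  for q d lam T where
  init: "alt_greedy q d lam T 0 {}"
| step: "alt_greedy q d lam T n S \<Longrightarrow>
    is_arg_max
      (\<lambda>t. 1/2 * lam * (Qual q (S \<union> {t}) - Qual q S) + (1 - lam) * (Div d (S \<union> {t}) - Div d S))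
      (\<lambda>t. t \<in> T - S) t \<Longrightarrow>
    alt_greedy q d lam T (Suc n) (S \<union> {t})"

text \<open>
  \<open>dgds q d k lam l U R\<close> holds iff \<open>R\<close> is a possible output of the distributed algorithm with
  \<open>l\<close> parts, for some admissible outcome of the random partition and some tie-breaking.
\<close>

definition dgds ::
  "('a \<Rightarrow> real) \<Rightarrow> ('a \<Rightarrow> 'a \<Rightarrow> real) \<Rightarrow> nat \<Rightarrow> real \<Rightarrow> nat \<Rightarrow> 'a set \<Rightarrow> 'a set \<Rightarrow> bool" where
  "dgds q d k lam l U R \<longleftrightarrow>
    (\<exists>P S. disjoint_family_on P {..<l} \<and> (\<Union>i<l. P i) = U \<and>
      (\<forall>i<l. card (P i) \<ge> k) \<and>
      (\<forall>i<l. alg1 q d lam (P i) k (S i)) \<and>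
      alt_greedy q d lam (\<Union>i<l. S i) k R)"

end

theory Submission imports Defs begin

text \<open>
  Rescale so that \<open>F = Q + D\<close>.  Both selection rules are then one greedy rule maximizing
  \<open>p t + (\<Sum>u\<in>S. d t u)\<close>: with \<open>p = q\<close> for ALG1 and \<open>p = q / 4\<close> for AltGreedy, since
  adding \<open>t\<close> raises the ordered sum \<open>D\<close> by twice its distance to \<open>S\<close>.  An element rejected by
  this rule has small quality and small total distance to the selected set.

  Let \<open>T\<close> be the union of the core sets \<open>S i\<close>, \<open>R\<close> the output and
  \<open>h x = q x + 2 (k - 1) / k * (\<Sum>u\<in>R. d x u)\<close>.  The triangle inequality through the points of
  \<open>R\<close> gives \<open>F Opt \<le> (\<Sum>x\<in>Opt. h x)\<close>.  If \<open>x\<close> was rejected by AltGreedy, then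
  \<open>h x \<le> (Q R + 3 D R) / k\<close>.  If \<open>x\<close> was rejected in part \<open>i\<close>, the triangle inequality through
  \<open>S i\<close> bounds \<open>h x\<close> by the average of \<open>h\<close> over \<open>S i\<close> plus \<open>4 F (S i) / k\<close>, and
  \<open>F (S i) \<le> 2 F R\<close> because AltGreedy is a 2-approximation on \<open>T\<close>.  Summing over \<open>Opt\<close> even
  gives \<open>F Opt \<le> 15 F R\<close>.
\<close>

section \<open>A common greedy rule for ALG1 and AltGreedy\<close>

inductive greedy :: "('a \<Rightarrow> real) \<Rightarrow> ('a \<Rightarrow> 'a \<Rightarrow> real) \<Rightarrow> 'a set \<Rightarrow> nat \<Rightarrow> 'a set \<Rightarrow> bool"
  for p d T where
  init: "greedy p d T 0 {}"
| step: "greedy p d T n S \<Longrightarrow> is_arg_max (\<lambda>t. p t + (\<Sum>u\<in>S. d t u)) (\<lambda>t. t \<in> T - S) t \<Longrightarrow>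
    greedy p d T (Suc n) (insert t S)"

lemma greedy_card:
  assumes "greedy p d T n S"
  shows "S \<subseteq> T \<and> finite S \<and> card S = n"
  using assms by induction (auto simp: is_arg_max_def)

lemma greedy_if_alg1:
  assumes "alg1 q d lam T n S" "0 < lam"
  shows "greedy (\<lambda>t. lam * q t) (\<lambda>t u. (1 - lam) * d t u) T n S"
  using assms(1)
proof induction
  case (init t)
  \<comment> \<open>With nothing selected the distance sum is empty, and \<open>0 < lam\<close>
    gives \<open>q\<close> and \<open>lam * q\<close> the same maximizers, so the first choice of
    ALG1 is an ordinary greedy step.\<close>
  then have "is_arg_max (\<lambda>t. lam * q t + (\<Sum>u\<in>{}. (1 - lam) * d t u)) (\<lambda>t. t \<in> T - {}) t"
    using assms(2) by (auto simp: is_arg_max_linorder)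
  from greedy.step[OF greedy.init this] show ?case by simp
next
  case (step n S t)
  from greedy.step[OF step.IH, of t] step.hyps(2) show ?case
    by (simp add: sum_distrib_left)
qed

lemma Div_eq: "Div d S = (\<Sum>u\<in>S. \<Sum>v\<in>S. d u v)"
  by (simp add: Div_def sum.cartesian_product)

lemma Qual_nonneg: "(\<And>u. u \<in> S \<Longrightarrow> 0 \<le> q u) \<Longrightarrow> 0 \<le> Qual q S"
  by (simp add: Qual_def sum_nonneg)

context Metric_space
begin

lemma Div_nonneg: "0 \<le> Div d S"
  by (auto simp: Div_def intro!: sum_nonneg)

lemma Div_insert:
  assumes "finite S" "t \<in> M" "t \<notin> S"
  shows "Div d (insert t S) = Div d S + 2 * (\<Sum>u\<in>S. d t u)"
proof -
  have "(\<Sum>u\<in>S. d u t) = (\<Sum>u\<in>S. d t u)"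
    by (simp add: commute)
  then show ?thesis
    using assms by (simp add: Div_eq sum.distrib)
qed

lemma greedy_if_alt_greedy:
  assumes "alt_greedy q d' lam T n S" "d = (\<lambda>t u. (1 - lam) * d' t u)" "T \<subseteq> M"
  shows "greedy (\<lambda>t. lam * q t / 4) d T n S"
  using assms(1)
proof induction
  case init
  show ?case by (rule greedy.init)
next
  case (step n S t)
  note S = greedy_card[OF step.IH]
  have "1/2 * lam * (Qual q (S \<union> {t}) - Qual q S) + (1 - lam) * (Div d' (S \<union> {t}) - Div d' S)
      = 2 * (lam * q t / 4 + (\<Sum>u\<in>S. d t u))" if "t \<in> T - S" for t
  proof -
    have "(1 - lam) * Div d' A = Div d A" for A
      unfolding Div_def assms(2) by (simp add: sum_distrib_left case_prod_unfold)
    moreover have "t \<in> M"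
      using that assms(3) by auto
    ultimately show ?thesis
      using S that Div_insert[of S t] by (simp add: right_diff_distrib Qual_def)
  qed
  then have "is_arg_max (\<lambda>t. lam * q t / 4 + (\<Sum>u\<in>S. d t u)) (\<lambda>t. t \<in> T - S) t"
    using step.hyps(2) by (auto simp: is_arg_max_linorder simp del: Un_insert_right)
  from greedy.step[OF step.IH this] show ?case by simp
qed

section \<open>Triangle inequality estimates for sums of distances\<close>

lemma card_mult_dist_le:
  assumes "S \<subseteq> M" "x \<in> M" "y \<in> M"
  shows "card S * d x y \<le> (\<Sum>u\<in>S. d x u) + (\<Sum>u\<in>S. d y u)"
proof -
  have "(\<Sum>u\<in>S. d x y) \<le> (\<Sum>u\<in>S. d x u + d y u)"
    using assms by (intro sum_mono) (metis commute subsetD triangle)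
  then show ?thesis by (simp add: sum.distrib)
qed

text \<open>Route every ordered pair of distinct points through \<open>p\<close>: each
  \<open>c\<close> occurs in \<open>2 * (card C - 1)\<close> of them. The vanishing diagonal
  accounts for the \<open>- 1\<close>.\<close>

lemma Div_le_star:
  assumes "finite C" "C \<subseteq> M" "p \<in> M"
  shows "Div d C \<le> 2 * (real (card C) - 1) * (\<Sum>c\<in>C. d c p)"
proof -
  let ?s = "\<Sum>c\<in>C. d c p"
  have "(\<Sum>c'\<in>C. d c c') \<le> (real (card C) - 2) * d c p + ?s" if c: "c \<in> C" for c
  proof -
    have "(\<Sum>c'\<in>C. d c c') = (\<Sum>c'\<in>C-{c}. d c c')"
      using assms c by (subst sum.remove[of C c]) auto
    also have "\<dots> \<le> (\<Sum>c'\<in>C-{c}. d c p + d c' p)"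
      using assms c by (intro sum_mono) (metis DiffD1 commute subsetD triangle)
    also have "\<dots> = (real (card C) - 1) * d c p + (?s - d c p)"
      using assms c card_gt_0_iff[of C]
      by (auto simp: sum.distrib sum_diff1 of_nat_diff)
    finally show ?thesis by (simp add: algebra_simps)
  qed
  then have "(\<Sum>c\<in>C. \<Sum>c'\<in>C. d c c') \<le> (\<Sum>c\<in>C. (real (card C) - 2) * d c p + ?s)"
    by (rule sum_mono)
  also have "\<dots> = 2 * (real (card C) - 1) * ?s"
    by (simp add: sum.distrib sum_distrib_left[symmetric]) (simp add: algebra_simps)
  finally show ?thesis by (simp add: Div_eq)
qed

text \<open>Using each point of \<open>B\<close> as hub in turn trades distances inside
  \<open>C\<close> for cross distances, the quantity that the greedy rule controls.\<close>

lemma card_mult_Div_le: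
  assumes "finite C" "C \<subseteq> M" "B \<subseteq> M"
  shows "card B * Div d C \<le> 2 * (real (card C) - 1) * (\<Sum>c\<in>C. \<Sum>b\<in>B. d c b)"
proof -
  have "(\<Sum>b\<in>B. Div d C) \<le> (\<Sum>b\<in>B. 2 * (real (card C) - 1) * (\<Sum>c\<in>C. d c b))"
    using assms by (intro sum_mono Div_le_star) auto
  also have "\<dots> = 2 * (real (card C) - 1) * (\<Sum>b\<in>B. \<Sum>c\<in>C. d c b)"
    by (simp add: sum_distrib_left)
  also have "(\<Sum>b\<in>B. \<Sum>c\<in>C. d c b) = (\<Sum>c\<in>C. \<Sum>b\<in>B. d c b)"
    by (rule sum.swap)
  finally show ?thesis by simp
qed

section \<open>Guarantees for a single greedy run\<close>

lemma greedy_dist_le: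
  assumes "greedy p d T n S" "T \<subseteq> M" "x \<in> T - S"
  shows "(real n - 1) * (\<Sum>u\<in>S. d x u) + 2 * n * p x \<le> 2 * Qual p S + 3/2 * Div d S"
  using assms(1,3)
proof induction
  case init
  then show ?case by (simp add: Qual_def Div_def)
next
  case (step n S t)
  note S = greedy_card[OF step.hyps(1)]
  have t: "t \<in> T" "t \<notin> S" and x: "x \<in> T" "x \<notin> S"
    using step by (auto simp: is_arg_max_def)
  have max: "p x + (\<Sum>u\<in>S. d x u) \<le> p t + (\<Sum>u\<in>S. d t u)"
    using step.hyps(2) x by (auto simp: is_arg_max_linorder)
  have tri: "n * d x t \<le> (\<Sum>u\<in>S. d x u) + (\<Sum>u\<in>S. d t u)"
    using card_mult_dist_le[of S x t] S t x assms(2) by auto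
  have IH: "(real n - 1) * (\<Sum>u\<in>S. d x u) + 2 * n * p x \<le> 2 * Qual p S + 3/2 * Div d S"
    using step.IH x by simp
  have "Div d (insert t S) = Div d S + 2 * (\<Sum>u\<in>S. d t u)"
    using Div_insert[of S t] S t assms(2) by auto
  moreover have "Qual p (insert t S) = Qual p S + p t"
    using S t by (simp add: Qual_def)
  moreover have "(\<Sum>u\<in>insert t S. d x u) = (\<Sum>u\<in>S. d x u) + d x t"
    using S t by simp
  \<comment> \<open>The left side grows by
    \<open>(\<Sum>u\<in>S. d x u) + n * d x t + 2 * p x\<close>. Adding \<open>tri\<close> to twice
    \<open>max\<close> bounds this by \<open>2 * p t + 3 * (\<Sum>u\<in>S. d t u)\<close>, exactly
    the growth of the right side.\<close>
  ultimately show ?case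
    using IH max tri by (simp add: algebra_simps)
qed

text \<open>This is the distance estimate in the Borodin--Lee--Ye analysis of greedy max-sum
  diversification: it bounds the average gain available in \<open>S - R\<close>.\<close>

lemma cross_dist_ge:
  assumes "R \<subseteq> M" "S \<subseteq> M" "finite R" "finite S" "card R < card S"
  shows "card R * card (S - R) * Div d S
    \<le> 2 * card S * (real (card S) - 1) * (\<Sum>c\<in>S-R. \<Sum>r\<in>R. d c r)"
proof -
  define A B C where "A = S \<inter> R" and "B = R - S" and "C = S - R"
  define a b c where "a = real (card A)" and "b = real (card B)" and "c = real (card C)"
  define X Y where "X = (\<Sum>c\<in>C. \<Sum>r\<in>A. d c r)" and "Y = (\<Sum>c\<in>C. \<Sum>r\<in>B. d c r)"
  have fin: "finite A" "finite B" "finite C" and sub: "A \<subseteq> M" "B \<subseteq> M" "C \<subseteq> M"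
    using assms by (auto simp: A_def B_def C_def)
  have disj: "A \<inter> C = {}" "A \<inter> B = {}" and S: "S = A \<union> C" and R: "R = A \<union> B"
    by (auto simp: A_def B_def C_def)
  have k: "real (card S) = a + c" and i: "real (card R) = a + b"
    using fin disj by (simp_all add: S R card_Un_disjoint a_def b_def c_def)
  have N: "(\<Sum>c\<in>C. \<Sum>r\<in>R. d c r) = X + Y"
    using fin disj by (simp add: R X_def Y_def sum.union_disjoint sum.distrib)
  have X': "(\<Sum>r\<in>A. \<Sum>c\<in>C. d r c) = X"
    unfolding X_def by (subst sum.swap) (simp add: commute)
  have DS: "Div d S = Div d A + 2 * X + Div d C"
    using fin disj X' unfolding X_def
    by (simp add: S Div_eq sum.union_disjoint sum.distrib)
  have nn: "0 \<le> a" "0 \<le> b" "0 \<le> c" "0 \<le> X" "0 \<le> Y" "0 \<le> Div d C"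
    by (auto simp: a_def b_def c_def X_def Y_def Div_nonneg intro!: sum_nonneg)
  have cb: "b \<le> c"
    using assms(5) k i by linarith
  have DA: "c * Div d A \<le> 2 * (a - 1) * X"
    using card_mult_Div_le[OF fin(1) sub(1) sub(3)] by (simp add: X' a_def c_def)
  have "a * Div d C \<le> 2 * (c - 1) * X"
    using card_mult_Div_le[OF fin(3) sub(3) sub(1)] by (simp add: X_def a_def c_def)
  also have "\<dots> \<le> 2 * (a + c - 1) * X"
    using nn by (intro mult_right_mono) auto
  finally have DX: "a * Div d C \<le> 2 * (a + c - 1) * X" .
  have "b * Div d C \<le> 2 * (c - 1) * Y"
    using card_mult_Div_le[OF fin(3) sub(3) sub(2)] by (simp add: Y_def b_def c_def)
  also have "\<dots> \<le> 2 * (a + c - 1) * Y"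
    using nn by (intro mult_right_mono) auto
  finally have DY: "b * Div d C \<le> 2 * (a + c - 1) * Y" .
  \<comment> \<open>The weight \<open>(a + b) * c\<close> of \<open>Div d C\<close> is split as
    \<open>(c - b) * a + (a + c) * b\<close>, so that \<open>X\<close> and \<open>Y\<close> end up
    with the same coefficient; \<open>cb\<close> keeps the first weight nonnegative.\<close>
  have "(a + b) * c * Div d S
      = (a + b) * (c * Div d A) + (a + b) * 2 * c * X + (c - b) * (a * Div d C) + (a + c) * (b * Div d C)"
    by (simp add: DS algebra_simps)
  also have "\<dots> \<le> (a + b) * (2 * (a - 1) * X) + (a + b) * 2 * c * X
      + (c - b) * (2 * (a + c - 1) * X) + (a + c) * (2 * (a + c - 1) * Y)"
    using nn cb DA DX DY by (intro add_mono mult_left_mono) auto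
  also have "\<dots> = 2 * (a + c) * (a + c - 1) * (X + Y)"
    by (simp add: algebra_simps)
  finally show ?thesis
    using k i N by (simp add: C_def[symmetric] c_def)
qed

text \<open>The term \<open>n / k * Qual p R\<close> on the right pays for the elements of \<open>S\<close> already
  selected, which keeps the statement inductive in \<open>n\<close>.\<close>

lemma greedy_ge_prefix:
  assumes "greedy p d T n R" "T \<subseteq> M" "\<And>u. u \<in> T \<Longrightarrow> 0 \<le> p u"
    and "S \<subseteq> T" "card S = k" "2 \<le> k" "n \<le> k"
  shows "n / k * Qual p S + n * (real n - 1) / (4 * k * (real k - 1)) * Div d S
    \<le> (1 + n / k) * Qual p R + Div d R / 2"
  using assms(1,7)
proof induction
  case init
  show ?case by (simp add: Qual_def Div_def)
next
  case (step n R t)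
  note R = greedy_card[OF step.hyps(1)]
  define C where "C = S - R"
  define g where "g = p t + (\<Sum>u\<in>R. d t u)"
  define N where "N = (\<Sum>c\<in>C. \<Sum>r\<in>R. d c r)"
  have S: "finite S" using assms(5,6) card.infinite by fastforce
  have t: "t \<in> T" "t \<notin> R"
    using step.hyps(2) by (auto simp: is_arg_max_def)
  have "card S \<le> card R" if "C = {}"
    using that R by (intro card_mono) (auto simp: C_def)
  then have C: "0 < card C" "card C \<le> k"
    using R S step.prems assms(5) card_mono[of S C] by (auto simp: C_def card_gt_0_iff)
  have p_nonneg: "0 \<le> Qual p C" "0 \<le> Qual p R" "0 \<le> p t"
    using assms(3,4) R t by (auto simp: C_def intro!: Qual_nonneg)
  \<comment> \<open>The selected gain is at least the average gain over the part \<open>C\<close> of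
    \<open>S\<close> still available.\<close>
  have "(\<Sum>c\<in>C. p c + (\<Sum>u\<in>R. d c u)) \<le> (\<Sum>c\<in>C. g)"
    unfolding g_def using step.hyps(2) assms(4)
    by (intro sum_mono) (auto simp: is_arg_max_linorder C_def)
  then have "Qual p C + N \<le> card C * g"
    by (simp add: sum.distrib Qual_def N_def)
  then have g: "Qual p C / card C + N / card C \<le> g"
    using C by (simp add: field_simps)
  have "Qual p S = Qual p C + Qual p (S \<inter> R)"
    using S sum.Int_Diff[of S p R] by (simp add: Qual_def C_def)
  moreover have "Qual p (S \<inter> R) \<le> Qual p R"
    unfolding Qual_def using R assms(3) by (intro sum_mono2) auto
  ultimately have "(Qual p S - Qual p R) / k \<le> Qual p C / k"
    using assms(6) by (intro divide_right_mono) auto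
  also have "\<dots> \<le> Qual p C / card C"
    using C p_nonneg by (intro divide_left_mono) auto
  finally have gQ: "(Qual p S - Qual p R) / k \<le> Qual p C / card C" .
  have "n * card C * Div d S \<le> 2 * k * (real k - 1) * N"
    using cross_dist_ge[of R S] R S assms step.prems by (auto simp: C_def N_def)
  then have gD: "n / (2 * k * (real k - 1)) * Div d S \<le> N / card C"
    using C assms(6) by (simp add: field_simps)
  have "Suc n / k * Qual p S + Suc n * (real (Suc n) - 1) / (4 * k * (real k - 1)) * Div d S
      = (n / k * Qual p S + n * (real n - 1) / (4 * k * (real k - 1)) * Div d S)
        + Qual p S / k + n / (2 * k * (real k - 1)) * Div d S"
  proof -
    have "real (Suc n) * (real (Suc n) - 1) = n * (real n - 1) + 2 * n"
      by (simp add: algebra_simps)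
    then show ?thesis
      using assms(6) by (simp add: add_divide_distrib distrib_right)
  qed
  also have "\<dots> \<le> ((1 + n / k) * Qual p R + Div d R / 2) + Qual p R / k + g"
    using step.IH step.prems g gQ gD by (simp add: diff_divide_distrib)
  \<comment> \<open>The coefficient of \<open>Qual p R\<close> grows by \<open>1 / k\<close>, which
    absorbs the loss from \<open>gQ\<close>; what remains is a nonnegative multiple of
    \<open>p t\<close>.\<close>
  also have "\<dots> \<le> (1 + Suc n / k) * (Qual p R + p t) + (Div d R + 2 * (\<Sum>u\<in>R. d t u)) / 2"
    using p_nonneg by (simp add: g_def algebra_simps add_divide_distrib)
  also have "\<dots> = (1 + Suc n / k) * Qual p (insert t R) + Div d (insert t R) / 2"
    using Div_insert[of R t] R t assms(2) by (auto simp: Qual_def)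
  finally show ?case by simp
qed

section \<open>Combining the core sets\<close>

lemma distributed_greedy_bound:
  fixes l :: nat
  assumes "finite M" "\<And>u. u \<in> M \<Longrightarrow> 0 \<le> q u" "2 \<le> k"
    and disj: "disjoint_family_on P {..<l}" and cover: "(\<Union>i<l. P i) = M"
    and core: "\<And>i. i < l \<Longrightarrow> greedy q d (P i) k (S i)"
    and R: "greedy (\<lambda>t. q t / 4) d (\<Union>i<l. S i) k R"
    and Opt: "Opt \<subseteq> M" "card Opt = k"
  shows "Qual q Opt + Div d Opt \<le> 15 * (Qual q R + Div d R)"
proof -
  let ?T = "\<Union>i<l. S i"
  \<comment> \<open>\<open>\<kappa>\<close> is the factor from \<open>card_mult_Div_le\<close> when
    pairs in \<open>Opt\<close> are routed through the \<open>k\<close> points of \<open>R\<close>.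
    Scaling \<open>greedy_dist_le\<close> by \<open>2 / k\<close> produces the same factor.\<close>
  define Q D \<kappa> where "Q = Qual q R" and "D = Div d R" and "\<kappa> = 2 * (real k - 1) / k"
  define e where "e = (Q + 3 * D) / k"
  define h where "h x = q x + \<kappa> * (\<Sum>u\<in>R. d x u)" for x
  \<comment> \<open>\<open>h\<close> has no uniform bound on \<open>R\<close>, only a bounded sum there; \<open>g\<close> isolates that part.\<close>
  define g where "g x = (if x \<in> R then h x else 0)" for x
  define G where "G i = (\<Sum>s\<in>S i. g s)" for i
  define E where "E = 8 * (Q + D) / k + e"
  have k: "0 < real k" "0 \<le> \<kappa>" "\<kappa> \<le> 2"
    using assms(3) by (auto simp: \<kappa>_def field_simps)
  have P: "P i \<subseteq> M" if "i < l" for i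
    using that cover by blast
  have S: "S i \<subseteq> P i" "finite (S i)" "card (S i) = k" if "i < l" for i
    using greedy_card[OF core[OF that]] by auto
  have T: "?T \<subseteq> M"
    using S(1) P by blast
  have RT: "R \<subseteq> ?T" "finite R" "card R = k"
    using greedy_card[OF R] by auto
  have RM: "R \<subseteq> M"
    using RT T by blast
  have finO: "finite Opt"
    using Opt(1) assms(1) by (rule finite_subset)
  have nn: "0 \<le> Q" "0 \<le> D"
    using RM assms(2) by (auto simp: Q_def D_def Div_nonneg intro!: Qual_nonneg)
  have e0: "0 \<le> e"
    using nn by (simp add: e_def)
  have dR0: "0 \<le> (\<Sum>u\<in>R. d x u)" for x
    by (simp add: sum_nonneg)
  have h0: "0 \<le> h x" "\<kappa> * (\<Sum>u\<in>R. d x u) \<le> h x" if "x \<in> M" for x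
    using assms(2)[OF that] k dR0[of x] by (auto simp: h_def)
  have g0: "0 \<le> g x" if "x \<in> M" for x
    using h0[OF that] by (simp add: g_def)
  have G0: "0 \<le> G i" if "i < l" for i
    unfolding G_def using S(1)[OF that] P[OF that] by (intro sum_nonneg g0) blast
  have hT: "h t \<le> g t + e" if t: "t \<in> ?T" for t
  proof (cases "t \<in> R")
    case True
    then show ?thesis using e0 by (simp add: g_def)
  next
    case False
    have "(real k - 1) * (\<Sum>u\<in>R. d t u) + k * q t / 2 \<le> Q / 2 + 3/2 * D"
      using greedy_dist_le[OF R T, of t] t False
      by (simp add: Q_def D_def Qual_def sum_divide_distrib[symmetric])
    then have "2 / k * ((real k - 1) * (\<Sum>u\<in>R. d t u) + k * q t / 2) \<le> 2 / k * (Q / 2 + 3/2 * D)"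
      by (rule mult_left_mono) simp
    moreover have "2 / k * ((real k - 1) * (\<Sum>u\<in>R. d t u) + k * q t / 2) = h t"
      using k by (simp add: h_def \<kappa>_def distrib_left)
    moreover have "2 / k * (Q / 2 + 3/2 * D) = e"
      by (simp add: e_def add_divide_distrib distrib_left)
    ultimately have "h t \<le> e" by simp
    then show ?thesis using False by (simp add: g_def)
  qed
  have core_value: "Qual q (S i) + Div d (S i) \<le> 2 * (Q + D)" if i: "i < l" for i
  proof -
    have "S i \<subseteq> ?T" using i by blast
    \<comment> \<open>At \<open>n = k\<close> the diversity coefficient is \<open>1 / 4\<close>,
      matching the quality \<open>q / 4\<close>, so the left side is a quarter of the
      objective.\<close>
    from greedy_ge_prefix[OF R T _ this S(3)[OF i] assms(3) order_refl]
    have "Qual (\<lambda>t. q t / 4) (S i) + Div d (S i) / 4 \<le> 2 * Qual (\<lambda>t. q t / 4) R + D / 2"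
      using assms(2,3) T by (force simp: D_def)
    then show ?thesis
      by (simp add: Qual_def Q_def sum_divide_distrib[symmetric])
  qed
  have hP: "h x \<le> 8 * (Q + D) / k + e + G i / k" if i: "i < l" and x: "x \<in> P i - S i" for i x
  proof -
    let ?dS = "\<Sum>s\<in>S i. d x s"
    have xM: "x \<in> M" using x P[OF i] by blast
    have SM: "S i \<subseteq> M" using S(1)[OF i] P[OF i] by blast
    have "(real k - 1) * ?dS + 2 * k * q x \<le> 2 * Qual q (S i) + 3/2 * Div d (S i)"
      using greedy_dist_le[OF core[OF i] P[OF i] x] by simp
    also have "\<dots> \<le> 4 * (Q + D)"
      using core_value[OF i] Div_nonneg[of "S i"] by linarith
    finally have "2 / k * ((real k - 1) * ?dS + 2 * k * q x) \<le> 2 / k * (4 * (Q + D))"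
      by (rule mult_left_mono) simp
    moreover have "2 / k * ((real k - 1) * ?dS + 2 * k * q x) = \<kappa> * ?dS + 4 * q x"
      using k by (simp add: \<kappa>_def distrib_left)
    \<comment> \<open>The term \<open>- 4 * q x\<close> is kept to pay for the summand
      \<open>q x\<close> of \<open>h x\<close>.\<close>
    ultimately have far: "\<kappa> * ?dS \<le> 8 * (Q + D) / k - 4 * q x"
      by simp
    have "(\<Sum>r\<in>R. k * d x r) \<le> (\<Sum>r\<in>R. ?dS + (\<Sum>s\<in>S i. d r s))"
      using card_mult_dist_le[OF SM xM] RM S(3)[OF i] by (intro sum_mono) auto
    also have "\<dots> = k * ?dS + (\<Sum>r\<in>R. \<Sum>s\<in>S i. d r s)"
      using RT by (simp add: sum.distrib)
    also have "(\<Sum>r\<in>R. \<Sum>s\<in>S i. d r s) = (\<Sum>s\<in>S i. \<Sum>r\<in>R. d s r)"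
      by (subst sum.swap) (simp add: commute)
    finally have "(\<Sum>r\<in>R. d x r) \<le> ?dS + (\<Sum>s\<in>S i. \<Sum>r\<in>R. d s r) / k"
      using k by (simp add: sum_distrib_left[symmetric] field_simps)
    then have "\<kappa> * (\<Sum>r\<in>R. d x r) \<le> \<kappa> * (?dS + (\<Sum>s\<in>S i. \<Sum>r\<in>R. d s r) / k)"
      using k by (intro mult_left_mono)
    also have "\<dots> = \<kappa> * ?dS + (\<Sum>s\<in>S i. \<kappa> * (\<Sum>r\<in>R. d s r)) / k"
      by (simp add: distrib_left sum_distrib_left)
    \<comment> \<open>Every element of \<open>S i\<close> was a candidate for AltGreedy, so
      \<open>hT\<close> applies to it.\<close>
    also have "(\<Sum>s\<in>S i. \<kappa> * (\<Sum>r\<in>R. d s r)) \<le> (\<Sum>s\<in>S i. g s + e)"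
    proof (rule sum_mono)
      fix s assume s: "s \<in> S i"
      then have "s \<in> ?T" using i by blast
      from hT[OF this] show "\<kappa> * (\<Sum>r\<in>R. d s r) \<le> g s + e"
        using h0(2)[of s] SM s by force
    qed
    also have "\<dots> = G i + k * e"
      using S[OF i] by (simp add: sum.distrib G_def)
    finally have "\<kappa> * (\<Sum>r\<in>R. d x r) \<le> \<kappa> * ?dS + (G i + k * e) / k"
      using k by (simp add: divide_right_mono)
    then show ?thesis
      using far k assms(2)[OF xM] by (simp add: h_def add_divide_distrib)
  qed
  \<comment> \<open>One \<open>G i\<close> covers the elements of \<open>Opt\<close> inside
    \<open>S i\<close>; the other covers the at most \<open>k\<close> shares
    \<open>G i / k\<close>.\<close>
  have part: "(\<Sum>x\<in>Opt \<inter> P i. h x) \<le> 2 * G i + card (Opt \<inter> P i) * E" if i: "i < l" for i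
  proof -
    let ?n = "real (card (Opt \<inter> P i))"
    have SM: "S i \<subseteq> M" using S(1)[OF i] P[OF i] by blast
    have "h x \<le> (if x \<in> S i then g x else 0) + (E + G i / k)" if "x \<in> P i" for x
    proof (cases "x \<in> S i")
      case True
      then have "h x \<le> g x + e" using hT i by blast
      moreover have "0 \<le> 8 * (Q + D) / k" "0 \<le> G i / k"
        using nn G0[OF i] by auto
      ultimately show ?thesis using True by (simp add: E_def)
    next
      case False
      then show ?thesis using hP[OF i] that by (simp add: E_def)
    qed
    then have "(\<Sum>x\<in>Opt \<inter> P i. h x)
        \<le> (\<Sum>x\<in>Opt \<inter> P i. (if x \<in> S i then g x else 0) + (E + G i / k))"
      by (intro sum_mono) auto
    also have "\<dots> = (\<Sum>x\<in>Opt \<inter> P i \<inter> S i. g x) + ?n * (E + G i / k)"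
      using finO by (simp add: sum.distrib sum.inter_restrict)
    also have "(\<Sum>x\<in>Opt \<inter> P i \<inter> S i. g x) \<le> G i"
      unfolding G_def using S(2)[OF i] SM g0 by (intro sum_mono2) auto
    also have "?n * (E + G i / k) \<le> ?n * E + G i"
    proof -
      have "card (Opt \<inter> P i) \<le> k"
        using finO Opt(2) card_mono[of Opt "Opt \<inter> P i"] by auto
      then have "?n * G i \<le> k * G i"
        using G0[OF i] by (intro mult_right_mono) auto
      then show ?thesis using k by (simp add: field_simps)
    qed
    finally show ?thesis by simp
  qed
  have disjI: "i < l \<Longrightarrow> j < l \<Longrightarrow> i \<noteq> j \<Longrightarrow> P i \<inter> P j = {}" for i j
    using disj by (auto simp: disjoint_family_on_def)
  have split: "Opt = (\<Union>i<l. Opt \<inter> P i)"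
    using Opt cover by blast
  have sumO: "(\<Sum>x\<in>Opt. f x) = (\<Sum>i<l. \<Sum>x\<in>Opt \<inter> P i. f x)" for f :: "'a \<Rightarrow> real"
    by (subst split, rule sum.UNION_disjoint) (use finO disjI in auto)
  \<comment> \<open>Disjointness counts each core element once, and \<open>g\<close> vanishes off
    \<open>R\<close>, so only \<open>h\<close> on \<open>R\<close> survives.\<close>
  have "(\<Sum>i<l. G i) = (\<Sum>x\<in>?T. g x)"
    unfolding G_def using S disjI by (intro sum.UNION_disjoint[symmetric]) (auto, blast)
  also have "\<dots> = (\<Sum>x\<in>R. h x)"
    unfolding g_def using S(2) RT by (subst sum.inter_restrict[symmetric]) (auto simp: Int_absorb1)
  also have "\<dots> = Q + \<kappa> * D"
    by (simp add: h_def Q_def D_def Qual_def Div_eq sum.distrib sum_distrib_left[symmetric])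
  also have "\<dots> \<le> Q + 2 * D"
    using k nn by (simp add: mult_right_mono)
  finally have sumG: "(\<Sum>i<l. G i) \<le> Q + 2 * D" .
  have "k * Div d Opt \<le> 2 * (real k - 1) * (\<Sum>x\<in>Opt. \<Sum>r\<in>R. d x r)"
    using card_mult_Div_le[OF finO Opt(1) RM] RT Opt by simp
  then have "Div d Opt \<le> \<kappa> * (\<Sum>x\<in>Opt. \<Sum>r\<in>R. d x r)"
    using k by (simp add: \<kappa>_def field_simps)
  then have "Qual q Opt + Div d Opt \<le> (\<Sum>x\<in>Opt. h x)"
    by (simp add: h_def sum.distrib Qual_def sum_distrib_left)
  also have "\<dots> \<le> (\<Sum>i<l. 2 * G i + card (Opt \<inter> P i) * E)"
    unfolding sumO[of h] using part by (intro sum_mono) auto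
  also have "\<dots> = 2 * (\<Sum>i<l. G i) + k * E"
    using sumO[of "\<lambda>_. 1"] Opt
    by (simp add: sum.distrib sum_distrib_left[symmetric] sum_distrib_right[symmetric])
  \<comment> \<open>With \<open>sumG\<close> the total is at most
    \<open>2 * (Q + 2 * D) + 9 * Q + 11 * D = 11 * Q + 15 * D\<close>.\<close>
  also have "k * E = 8 * (Q + D) + (Q + 3 * D)"
    using k by (simp add: E_def e_def field_simps)
  finally show ?thesis
    using sumG nn by (simp add: Q_def D_def)
qed

end

section \<open>Absorbing the weights into quality and metric\<close>

theorem theorem4:
  fixes U Opt R :: "'a set" and q :: "'a \<Rightarrow> real" and d :: "'a \<Rightarrow> 'a \<Rightarrow> real"
    and k l :: nat and lam :: real
  assumes "k \<ge> 2" and "0 < lam" and "lam < 1"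
    and "finite U"
    and "\<And>u. u \<in> U \<Longrightarrow> 0 \<le> q u"
    and "Metric_space U d"
    and "is_arg_max (Obj q d lam) (\<lambda>S. S \<subseteq> U \<and> card S = k) Opt"
    and "dgds q d k lam l U R"
  shows "Obj q d lam R \<ge> 1/16 * Obj q d lam Opt"
proof -
  define q' d' where "q' = (\<lambda>t. lam * q t)" and "d' = (\<lambda>t u. (1 - lam) * d t u)"
  interpret d: Metric_space U d by fact
  \<comment> \<open>Strictness of \<open>lam < 1\<close> keeps distinct points at nonzero
    distance.\<close>
  interpret d': Metric_space U d'
  proof
    show "d' x z \<le> d' x y + d' y z" if "x \<in> U" "y \<in> U" "z \<in> U" for x y z
      using d.triangle[OF that] assms(3) by (simp add: d'_def distrib_left[symmetric])
  qed (use assms(3) in \<open>auto simp: d'_def d.commute\<close>)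
  have Obj: "Obj q d lam A = Qual q' A + Div d' A" for A
    by (simp add: Obj_def Qual_def Div_def q'_def d'_def sum_distrib_left case_prod_unfold)
  have q'_nonneg: "0 \<le> q' u" if "u \<in> U" for u
    using assms(2,5) that by (simp add: q'_def)
  obtain P S where P: "disjoint_family_on P {..<l}" "(\<Union>i<l. P i) = U"
    and S: "\<And>i. i < l \<Longrightarrow> alg1 q d lam (P i) k (S i)"
    and R: "alt_greedy q d lam (\<Union>i<l. S i) k R"
    using assms(8) unfolding dgds_def by blast
  have core: "greedy q' d' (P i) k (S i)" if "i < l" for i
    unfolding q'_def d'_def using S[OF that] assms(2) by (rule greedy_if_alg1)
  have SU: "(\<Union>i<l. S i) \<subseteq> U"
    using greedy_card[OF core] P(2) by blast
  have "greedy (\<lambda>t. q' t / 4) d' (\<Union>i<l. S i) k R"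
    unfolding q'_def using R d'_def SU by (rule d'.greedy_if_alt_greedy)
  moreover have "Opt \<subseteq> U" "card Opt = k"
    using assms(7) by (auto simp: is_arg_max_def)
  ultimately have "Obj q d lam Opt \<le> 15 * Obj q d lam R"
    unfolding Obj using assms(1,4) q'_nonneg P core
    by (intro d'.distributed_greedy_bound[of q' k P l S R Opt]) auto
  moreover have "0 \<le> Obj q d lam R"
    using \<open>greedy _ d' _ k R\<close> greedy_card SU q'_nonneg
    unfolding Obj by (intro add_nonneg_nonneg Qual_nonneg d'.Div_nonneg) blast
  ultimately show ?thesis by simp
qed

end
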